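(* Let $t_0<t_1<\dots<t_N=T$ be consecutive time steps, and for $t_i\in\{t_0,\dots,T-1\}$ and $x\in\mathcal{X}_{t_i}$ let $P_{t_i}(x)$ be the deterministic optimal control problem defined in the context. Assume that $P_{t_i}(x)$ has a solution for every $t_i\in\{t_0,\dots,T-1\}$ and every $x\in\mathcal{X}_{t_i}$. Then the problems are time consistent when strategies are sought as feedback functions of the state variable: there exist feedback functions $\Phi^*_{t_0,t}:\mathcal{X}_t\to\mathcal{U}_t$, $t=t_0,\dots,T-1$, such that $(\Phi^*_{t_0,t_0},\dots,\Phi^*_{t_0,T-1})$ is optimal for the original problem starting at $t_0$ and, for every $t_i\in\{t_0,\dots,T-1\}$, $(\Phi^*_{t_0,t_i},\dots,\Phi^*_{t_0,T-1})$ is optimal for $P_{t_i}(x)$, whatever the initial condition $x\in\mathcal{X}_{t_i}$ is.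
   Context: Time is discrete and finite: $t_0,t_1,\dots,t_N=T$ with $t_i+1=t_{i+1}$. For each $t\in\{t_0,\dots,T\}$, $\mathcal{X}_t$ is a set (state space); for each $t\in\{t_0,\dots,T-1\}$, $\mathcal{U}_t$ is a set (control space), $f_t:\mathcal{X}_t\times\mathcal{U}_t\to\mathcal{X}_{t+1}$ is the dynamics and $L_t:\mathcal{X}_t\times\mathcal{U}_t\to\mathbb{R}$ is the cost at time $t$; $K:\mathcal{X}_T\to\mathbb{R}$ is a final cost. For $t_i\in\{t_0,\dots,T-1\}$ and $x\in\mathcal{X}_{t_i}$, $P_{t_i}(x)$ is the problem of minimizing $$\sum_{t=t_i}^{T-1}L_t(x_t,u_t)+K(x_T)$$ over controls $u_t\in\mathcal{U}_t$, $t=t_i,\dots,T-1$, subject to $x_{t_i}=x$ and $x_{t+1}=f_t(x_t,u_t)$ for all $t=t_i,\dots,T-1$. The original problem is the one starting at $t_0$ from a given initial state. A family of feedback functions $\Phi_t:\mathcal{X}_t\to\mathcal{U}_t$, $t=t_i,\dots,T-1$, is optimal for $P_{t_i}(x)$ if the controls $u_t=\Phi_t(x_t)$ generated along the trajectory $x_{t_i}=x$, $x_{t+1}=f_t(x_t,\Phi_t(x_t))$ form an optimal control sequence for $P_{t_i}(x)$. Time consistency (dynamic consistency) means that optimal strategies obtained when solving the original problem at time $t_0$ remain optimal for all subsequent problems. *)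

theory Defs
  imports Complex_Main "HOL-Library.FuncSet"
begin

(* State and control spaces are subsets X t and U t of two ambient types, and f, L, K are total on
   these types. If f t maps X t and U t into X (t + 1), a trajectory that starts in X s under
   controls in U t has its states in X t, so X does not occur in the definitions and the values
   of f, L, K elsewhere play no role. *)

definition trajectory ::
  "int \<Rightarrow> (int \<Rightarrow> 'x \<Rightarrow> 'u \<Rightarrow> 'x) \<Rightarrow> int \<Rightarrow> 'x \<Rightarrow> (int \<Rightarrow> 'u) \<Rightarrow> (int \<Rightarrow> 'x) \<Rightarrow> bool"
where
  "trajectory T f s x u xs \<longleftrightarrow>
     xs s = x \<and> (\<forall>t\<in>{s..<T}. xs (t + 1) = f t (xs t) (u t))"

definition total_cost ::
  "int \<Rightarrow> (int \<Rightarrow> 'x \<Rightarrow> 'u \<Rightarrow> real) \<Rightarrow> ('x \<Rightarrow> real) \<Rightarrow> int \<Rightarrow> (int \<Rightarrow> 'u) \<Rightarrow> (int \<Rightarrow> 'x) \<Rightarrow> real"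
where
  "total_cost T L K s u xs = (\<Sum>t\<in>{s..<T}. L t (xs t) (u t)) + K (xs T)"

definition feasible ::
  "int \<Rightarrow> (int \<Rightarrow> 'u set) \<Rightarrow> (int \<Rightarrow> 'x \<Rightarrow> 'u \<Rightarrow> 'x) \<Rightarrow> int \<Rightarrow> 'x \<Rightarrow> (int \<Rightarrow> 'u) \<times> (int \<Rightarrow> 'x) \<Rightarrow> bool"
where
  "feasible T U f s x = (\<lambda>(u, xs). u \<in> Pi {s..<T} U \<and> trajectory T f s x u xs)"

(* A trajectory is determined by u and x at the times s, ..., T, and the cost depends on nothing
   else, so the existential quantifier over xs only names the trajectory generated by u. *)
definition optimal_controls ::
  "int \<Rightarrow> (int \<Rightarrow> 'u set) \<Rightarrow> (int \<Rightarrow> 'x \<Rightarrow> 'u \<Rightarrow> 'x) \<Rightarrow> (int \<Rightarrow> 'x \<Rightarrow> 'u \<Rightarrow> real) \<Rightarrow> ('x \<Rightarrow> real) \<Rightarrow>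
   int \<Rightarrow> 'x \<Rightarrow> (int \<Rightarrow> 'u) \<Rightarrow> bool"
where
  "optimal_controls T U f L K s x u \<longleftrightarrow>
     (\<exists>xs. is_arg_min (\<lambda>(u', xs'). total_cost T L K s u' xs') (feasible T U f s x) (u, xs))"

(* As above, the closed-loop trajectory xs is determined by the feedbacks and x at s, ..., T. *)
definition optimal_feedback ::
  "int \<Rightarrow> (int \<Rightarrow> 'u set) \<Rightarrow> (int \<Rightarrow> 'x \<Rightarrow> 'u \<Rightarrow> 'x) \<Rightarrow> (int \<Rightarrow> 'x \<Rightarrow> 'u \<Rightarrow> real) \<Rightarrow> ('x \<Rightarrow> real) \<Rightarrow>
   int \<Rightarrow> 'x \<Rightarrow> (int \<Rightarrow> 'x \<Rightarrow> 'u) \<Rightarrow> bool"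
where
  "optimal_feedback T U f L K s x \<Phi> \<longleftrightarrow>
     (\<exists>xs. trajectory T f s x (\<lambda>t. \<Phi> t (xs t)) xs \<and>
           optimal_controls T U f L K s x (\<lambda>t. \<Phi> t (xs t)))"

end

theory Submission
  imports Defs
begin

text \<open>Let the feedback \<open>\<Phi> s x\<close> be the first control of an arbitrary solution of the problem
  starting at \<open>(s, x)\<close>. Backward induction on \<open>s\<close> shows that the closed loop under \<open>\<Phi>\<close> is optimal
  from every state. At \<open>(s, x)\<close> the closed loop makes the same first move as the chosen solution, so
  both pay the same first cost and reach the same state \<open>y\<close>. From there the closed loop is optimal
  by induction, and the tail of the chosen solution is one of the competitors at \<open>(s + 1, y)\<close>.
  Hence the closed loop costs at most as much as the chosen solution, which costs at most as much as
  any other control. The induction is \<open>closed_loop_minimal\<close>.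

  The solutions selected at different initial conditions need not agree with each other: one problem
  can have several solutions, and the tail of the solution chosen at \<open>(s, x)\<close> may differ from the
  one chosen at \<open>(s + 1, y)\<close>. This does no harm, because the induction
  compares only their costs.\<close>

lemma interval_split_first:
  fixes s T :: int
  assumes "s < T"
  shows "{s..<T} = insert s {s + 1..<T}"
  using assms by auto

lemma total_cost_split_first:
  assumes "s < T"
  shows "total_cost T L K s u xs = L s (xs s) (u s) + total_cost T L K (s + 1) u xs"
  by (simp add: total_cost_def interval_split_first[OF assms])

lemma trajectory_tail:
  "trajectory T f s x u xs \<Longrightarrow> trajectory T f (s + 1) (xs (s + 1)) u xs"
  by (auto simp: trajectory_def)

lemma feasible_tail:
  "feasible T U f s x (u, xs) \<Longrightarrow> feasible T U f (s + 1) (xs (s + 1)) (u, xs)"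
  by (auto simp: feasible_def intro: trajectory_tail)

lemma closed_loop_trajectory_exists:
  fixes f :: "int \<Rightarrow> 'x \<Rightarrow> 'u \<Rightarrow> 'x"
  shows "\<exists>xs. trajectory T f s x (\<lambda>t. \<Phi> t (xs t)) xs"
proof -
  define g where
    "g = rec_nat x (\<lambda>n y. f (s + int n) y (\<Phi> (s + int n) y))"
  have "nat (t + 1 - s) = Suc (nat (t - s))" if "s \<le> t" for t
    using that by simp
  then have "trajectory T f s x (\<lambda>t. \<Phi> t (g (nat (t - s)))) (\<lambda>t. g (nat (t - s)))"
    by (auto simp: trajectory_def g_def)
  then show ?thesis
    by (intro exI[of _ "\<lambda>t. g (nat (t - s))"])
qed

text \<open>The states of a closed loop never leave the state spaces, because an admissible feedback
  applied in \<open>X t\<close> gives a control in \<open>U t\<close>, which leads to \<open>X (t + 1)\<close>.\<close>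

lemma closed_loop_feasible:
  assumes dyn: "\<And>t x u. t \<in> {s..<T} \<Longrightarrow> x \<in> X t \<Longrightarrow> u \<in> U t \<Longrightarrow> f t x u \<in> X (t + 1)"
    and adm: "\<And>t. t \<in> {s..<T} \<Longrightarrow> \<Phi> t \<in> X t \<rightarrow> U t"
    and "x \<in> X s"
    and traj: "trajectory T f s x (\<lambda>t. \<Phi> t (xs t)) xs"
  shows "feasible T U f s x (\<lambda>t. \<Phi> t (xs t), xs)"
proof -
  have "t \<le> T \<longrightarrow> xs t \<in> X t" if "s \<le> t" for t
    using that
  proof (induction t rule: int_ge_induct)
    case base
    then show ?case
      using \<open>x \<in> X s\<close> traj by (simp add: trajectory_def)
  next
    case (step t)
    show ?case
    proof
      assume "t + 1 \<le> T"
      then have t: "t \<in> {s..<T}" and "xs t \<in> X t"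
        using step by auto
      moreover have "\<Phi> t (xs t) \<in> U t"
        using adm[OF t] \<open>xs t \<in> X t\<close> by blast
      moreover have "xs (t + 1) = f t (xs t) (\<Phi> t (xs t))"
        using traj t by (simp add: trajectory_def)
      ultimately show "xs (t + 1) \<in> X (t + 1)"
        using dyn by simp
    qed
  qed
  then have "\<Phi> t (xs t) \<in> U t" if "t \<in> {s..<T}" for t
    using adm[OF that] that by auto
  then show ?thesis
    using traj by (auto simp: feasible_def)
qed

text \<open>The induction must cover all states in \<open>X s\<close> at once, because the state reached from \<open>x\<close>
  depends on the move that was selected. It starts at \<open>T\<close>, where only the final cost remains and
  every competitor pays the same.\<close>

lemma closed_loop_minimal:
  assumes dyn: "\<And>t x u. t \<in> {t0..<T} \<Longrightarrow> x \<in> X t \<Longrightarrow> u \<in> U t \<Longrightarrow> f t x u \<in> X (t + 1)"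
    and first: "\<And>t x. t \<in> {t0..<T} \<Longrightarrow> x \<in> X t \<Longrightarrow>
                  \<exists>u. optimal_controls T U f L K t x u \<and> \<Phi> t x = u t"
    and "s \<le> T" "t0 \<le> s" "x \<in> X s"
    and "trajectory T f s x (\<lambda>t. \<Phi> t (xs t)) xs"
    and "feasible T U f s x (v, ys)"
  shows "total_cost T L K s (\<lambda>t. \<Phi> t (xs t)) xs \<le> total_cost T L K s v ys"
  using assms(3-)
proof (induction s arbitrary: x xs v ys rule: int_le_induct)
  case base
  then show ?case
    by (simp add: total_cost_def feasible_def trajectory_def)
next
  case (step r)
  define s where "s = r - 1"
  have r: "r = s + 1" and s: "s < T" "s \<in> {t0..<T}"
    using step.hyps step.prems by (auto simp: s_def)
  let ?w = "\<lambda>t. \<Phi> t (xs t)"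
  have "x \<in> X s" and traj: "trajectory T f s x ?w xs" and v: "feasible T U f s x (v, ys)"
    using step.prems by (simp_all add: s_def)
  obtain u zs where u: "feasible T U f s x (u, zs)" and head: "\<Phi> s x = u s"
    and u_min: "total_cost T L K s u zs \<le> total_cost T L K s v ys"
    using first[OF s(2) \<open>x \<in> X s\<close>] v
    by (fastforce simp: optimal_controls_def is_arg_min_linorder)
  have "u s \<in> U s" and start: "xs s = x" "zs s = x"
    and next_state: "xs (s + 1) = f s x (u s)" "zs (s + 1) = f s x (u s)"
    using u traj s head by (auto simp: feasible_def trajectory_def)
  have "total_cost T L K r ?w xs \<le> total_cost T L K r u zs"
  proof (rule step.IH)
    show "t0 \<le> r"
      using s r by simp
    show "xs r \<in> X r"
      unfolding r next_state by (rule dyn[OF s(2) \<open>x \<in> X s\<close> \<open>u s \<in> U s\<close>])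
    show "trajectory T f r (xs r) ?w xs"
      using trajectory_tail[OF traj] by (simp add: r)
    show "feasible T U f r (xs r) (u, zs)"
      using feasible_tail[OF u] by (simp add: r next_state)
  qed
  then have "total_cost T L K s ?w xs \<le> total_cost T L K s u zs"
    by (simp add: total_cost_split_first[OF s(1)] start head r)
  also note u_min
  finally show ?case
    by (simp add: s_def)
qed

theorem lemma3:
  fixes t0 T :: int
    and X :: "int \<Rightarrow> 'x set"
    and U :: "int \<Rightarrow> 'u set"
    and f :: "int \<Rightarrow> 'x \<Rightarrow> 'u \<Rightarrow> 'x"
    and L :: "int \<Rightarrow> 'x \<Rightarrow> 'u \<Rightarrow> real"
    and K :: "'x \<Rightarrow> real"
    and x0 :: 'x
  assumes "t0 < T"
    and "\<And>t x u. t \<in> {t0..<T} \<Longrightarrow> x \<in> X t \<Longrightarrow> u \<in> U t \<Longrightarrow> f t x u \<in> X (t + 1)"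
    and "x0 \<in> X t0"
    and "\<And>s x. s \<in> {t0..<T} \<Longrightarrow> x \<in> X s \<Longrightarrow> \<exists>u. optimal_controls T U f L K s x u"
  shows "\<exists>\<Phi> :: int \<Rightarrow> 'x \<Rightarrow> 'u.
           (\<forall>t\<in>{t0..<T}. \<Phi> t \<in> X t \<rightarrow> U t) \<and>
           optimal_feedback T U f L K t0 x0 \<Phi> \<and>
           (\<forall>s\<in>{t0..<T}. \<forall>x\<in>X s. optimal_feedback T U f L K s x \<Phi>)"
proof -
  obtain w where w: "optimal_controls T U f L K s x (w s x)" if "s \<in> {t0..<T}" "x \<in> X s" for s x
    using assms(4) by metis
  define \<Phi> where "\<Phi> s x = w s x s" for s x
  have adm: "\<Phi> s \<in> X s \<rightarrow> U s" if "s \<in> {t0..<T}" for s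
  proof
    fix x
    assume "x \<in> X s"
    then show "\<Phi> s x \<in> U s"
      using w[OF that] that
      by (fastforce simp: optimal_controls_def is_arg_min_def feasible_def \<Phi>_def)
  qed
  have opt: "optimal_feedback T U f L K s x \<Phi>" if s: "s \<in> {t0..<T}" and x: "x \<in> X s" for s x
  proof -
    obtain xs where xs: "trajectory T f s x (\<lambda>t. \<Phi> t (xs t)) xs"
      using closed_loop_trajectory_exists by metis
    have "feasible T U f s x (\<lambda>t. \<Phi> t (xs t), xs)"
      by (rule closed_loop_feasible[where X = X]) (use s x xs adm assms(2) in auto)
    moreover have "total_cost T L K s (\<lambda>t. \<Phi> t (xs t)) xs \<le> total_cost T L K s v ys"
      if "feasible T U f s x (v, ys)" for v ys
    proof (rule closed_loop_minimal[where X = X and U = U and f = f and x = x and xs = xs and v = v])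
      show "\<exists>u. optimal_controls T U f L K t y u \<and> \<Phi> t y = u t"
        if "t \<in> {t0..<T}" "y \<in> X t" for t y
        using w[OF that] by (auto simp: \<Phi>_def)
    qed (use s x xs that assms(2) in auto)
    ultimately have "optimal_controls T U f L K s x (\<lambda>t. \<Phi> t (xs t))"
      by (auto simp: optimal_controls_def is_arg_min_linorder)
    then show ?thesis
      using xs by (auto simp: optimal_feedback_def)
  qed
  show ?thesis
    using adm opt assms(1,3) by (intro exI[of _ \<Phi>]) auto
qed

end
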